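(* If $T$ is a rotational tournament on $n=2k+1$ vertices, then either $T$ is isomorphic to $U_{n}$, or $O(u)\cap O(v)\neq\emptyset$ for all distinct $u,v\in V(T)$.
   Context: Let $S$ be a set of $k$ integers in $\{1,\dots,2k\}$ such that $i+j\neq 2k+1$ for all $i,j\in S$. The rotational tournament with symbol $S$ has vertices $0,1,\dots,2k$ and an arc $i\rightarrow j$ iff $j-i \pmod{2k+1}\in S$ (this is a tournament). $U_n$ denotes the rotational tournament on $n=2k+1$ vertices with symbol $\{1,2,\dots,\frac{n-1}{2}\}$. $O(v)$ is the set of vertices that $v$ beats. *)

theory Defs
  imports "Graph_Theory.Graph_Theory"
begin

definition rotational_symbol :: "nat \<Rightarrow> int set \<Rightarrow> bool" where
  "rotational_symbol k S \<longleftrightarrow>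
     S \<subseteq> {1..2 * int k} \<and> card S = k \<and> (\<forall>i\<in>S. \<forall>j\<in>S. i + j \<noteq> 2 * int k + 1)"

definition rotational_digraph :: "nat \<Rightarrow> int set \<Rightarrow> int pair_pre_digraph" where
  "rotational_digraph n S =
     \<lparr> pverts = {0..<int n},
       parcs = {(i, j). i \<in> {0..<int n} \<and> j \<in> {0..<int n} \<and> (j - i) mod int n \<in> S} \<rparr>"

definition rotational_tournament :: "nat \<Rightarrow> int pair_pre_digraph \<Rightarrow> bool" where
  "rotational_tournament k T \<longleftrightarrow>
     (\<exists>S. rotational_symbol k S \<and> T = rotational_digraph (2 * k + 1) S)"

text \<open>Meant for odd \<open>n\<close>, where the division by 2 is exact.\<close>

definition U_tournament :: "nat \<Rightarrow> int pair_pre_digraph" where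
  "U_tournament n = rotational_digraph n {1..(int n - 1) div 2}"

definition out_set :: "('a, 'b) pre_digraph \<Rightarrow> 'a \<Rightarrow> 'a set" where
  "out_set G v = {w \<in> verts G. v \<rightarrow>\<^bsub>G\<^esub> w}"

lemma wf_digraph_rotational_digraph: "wf_digraph (with_proj (rotational_digraph n S))"
  by unfold_locales (auto simp: rotational_digraph_def)

lemma rotational_tournament_U: "rotational_tournament k (U_tournament (2 * k + 1))"
  unfolding rotational_tournament_def U_tournament_def rotational_symbol_def
  by (rule exI[of _ "{1..int k}"]) auto

lemma rotational_symbol_neg:
  assumes "rotational_symbol k S" and "x \<in> {1..2 * int k}"
  shows "2 * int k + 1 - x \<in> S \<longleftrightarrow> x \<notin> S"
proof -
  define f where "f = (\<lambda>y::int. 2 * int k + 1 - y)"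
  have S: "S \<subseteq> {1..2 * int k}" "card S = k" "\<forall>i\<in>S. \<forall>j\<in>S. i + j \<noteq> 2 * int k + 1"
    using assms(1) by (auto simp: rotational_symbol_def)
  have fin: "finite S" using S(1) finite_subset by blast
  have inj: "inj_on f S" by (auto simp: f_def inj_on_def)
  have disj: "S \<inter> f ` S = {}" using S(3) by (force simp: f_def)
  have "card (S \<union> f ` S) = 2 * k"
    using card_Un_disjoint[OF fin _ disj] fin card_image[OF inj] S(2) by simp
  moreover have "S \<union> f ` S \<subseteq> {1..2 * int k}" using S(1) by (force simp: f_def)
  ultimately have "S \<union> f ` S = {1..2 * int k}"
    by (intro card_subset_eq) auto
  then have "x \<in> S \<or> x \<in> f ` S" using assms(2) by blast
  moreover have "x \<in> f ` S \<longleftrightarrow> f x \<in> S" by (force simp: f_def)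
  ultimately show ?thesis using disj by (auto simp: f_def)
qed

lemma rotational_tournament_arcs:
  assumes "rotational_tournament k T" and "u \<in> verts (with_proj T)" and "v \<in> verts (with_proj T)"
  shows "(u \<rightarrow>\<^bsub>with_proj T\<^esub> v) \<longleftrightarrow> u \<noteq> v \<and> \<not> (v \<rightarrow>\<^bsub>with_proj T\<^esub> u)"
proof -
  obtain S where S: "rotational_symbol k S" and T: "T = rotational_digraph (2 * k + 1) S"
    using assms(1) by (auto simp: rotational_tournament_def)
  define n where "n = 2 * int k + 1"
  have int_n: "int (2 * k + 1) = n" by (simp add: n_def)
  have uv: "u \<in> {0..<n}" "v \<in> {0..<n}"
    using assms(2,3) unfolding T rotational_digraph_def int_n by simp_all
  have arc: "(x \<rightarrow>\<^bsub>with_proj T\<^esub> y) \<longleftrightarrow> (y - x) mod n \<in> S" if "x \<in> {0..<n}" "y \<in> {0..<n}" for x y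
    using that unfolding T rotational_digraph_def int_n by simp
  show ?thesis
  proof (cases "u = v")
    case True
    then show ?thesis using S uv arc by (auto simp: rotational_symbol_def)
  next
    case False
    define x where "x = (v - u) mod n"
    have "n > 0" by (simp add: n_def)
    have "x \<noteq> 0" using False uv unfolding x_def
      by (metis atLeastLessThan_iff mod_pos_pos_trivial mod_eq_dvd_iff mod_0_imp_dvd)
    moreover have "0 \<le> x" "x < n" using \<open>n > 0\<close> by (auto simp: x_def)
    ultimately have "x \<in> {1..2 * int k}" by (auto simp: n_def)
    from rotational_symbol_neg[OF S this] have "n - x \<in> S \<longleftrightarrow> x \<notin> S" by (simp add: n_def)
    moreover have "(u - v) mod n = n - x"
      using \<open>x \<noteq> 0\<close> zmod_zminus1_eq_if[of "v - u" n] by (simp add: x_def)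
    ultimately show ?thesis using False arc uv by (simp add: x_def)
  qed
qed

end

theory Submission
  imports Defs
begin

text \<open>
  If \<open>O(u) \<inter> O(v) = {}\<close> and \<open>d = v - u\<close>, then \<open>S\<close> and \<open>S + d\<close> are disjoint modulo \<open>n = 2k + 1\<close>;
  exchanging \<open>u\<close> and \<open>v\<close> we may take \<open>d \<in> S\<close>. As exactly one of \<open>x, -x\<close> lies in \<open>S\<close> for \<open>x \<noteq> 0\<close>,
  \<open>x \<in> S\<close> gives \<open>-x - d \<in> S\<close>, and \<open>d - x \<in> S\<close> unless \<open>x = d\<close>. Hence, with \<open>c = -2d\<close>, the set \<open>S\<close> is
  closed under subtracting \<open>c\<close> except at \<open>c\<close> itself. An element \<open>x\<close> outside \<open>{c, 2c, \<dots>, kc}\<close> would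
  therefore yield \<open>x - kc = x - d \<in> S\<close> (because \<open>2k \<equiv> -1\<close>), contradicting disjointness. So
  \<open>S = {c, 2c, \<dots>, kc}\<close> by cardinality, \<open>c\<close> is a unit because \<open>1\<close> or \<open>-1\<close> lies in \<open>S\<close>, and
  division by \<open>c\<close> is an isomorphism onto \<open>U\<^sub>n\<close>.
\<close>

text \<open>Multiplication by \<open>e\<close>, inverse to \<open>c\<close> modulo \<open>n\<close>,
  permutes the residues and scales differences by \<open>e\<close>; so arcs correspond once
  \<open>R\<close> is the preimage of \<open>S\<close> under multiplication by
  \<open>c\<close>.\<close>

lemma rotational_digraph_iso_mult:
  fixes c e :: int
  assumes n: "n > 0" and unit: "(e * c) mod int n = 1 mod int n"
    and R: "\<And>x. x mod int n \<in> R \<longleftrightarrow> (c * x) mod int n \<in> S"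
  shows "digraph_iso (with_proj (rotational_digraph n S)) (with_proj (rotational_digraph n R))"
proof -
  define f where "f = (\<lambda>x. (e * x) mod int n)"
  have ce: "(c * ((e * x) mod int n)) mod int n = x mod int n" for x
    using unit by (metis mod_mult_left_eq mod_mult_right_eq mult.assoc mult.commute mult_1)
  have ec: "(e * ((c * x) mod int n)) mod int n = x mod int n" for x
    using unit by (metis mod_mult_left_eq mod_mult_right_eq mult.assoc mult_1)
  have f_range: "f x \<in> {0..<int n}" for x
    using n by (simp add: f_def)
  have inj: "inj_on f {0..<int n}"
    by (rule inj_on_inverseI[where g = "\<lambda>x. (c * x) mod int n"]) (simp add: f_def ce)
  have surj: "f ` {0..<int n} = {0..<int n}"
    by (rule endo_inj_surj) (use f_range inj in auto)
  have arc: "(f j - f i) mod int n \<in> R \<longleftrightarrow> (j - i) mod int n \<in> S" for i j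
  proof -
    have "(c * (f j - f i)) mod int n = (j - i) mod int n"
      unfolding right_diff_distrib f_def
      by (subst mod_diff_eq[symmetric]) (simp only: ce mod_diff_eq)
    then show ?thesis by (simp add: R)
  qed
  let ?hom = "\<lparr> iso_verts = f, iso_arcs = map_prod f f, iso_head = snd, iso_tail = fst \<rparr>"
  let ?T = "with_proj (rotational_digraph n S)"
  have "pre_digraph.digraph_isomorphism ?T ?hom"
    unfolding pre_digraph.digraph_isomorphism_def
    using inj wf_digraph_rotational_digraph[of n S]
    by (auto simp: rotational_digraph_def inj_on_def)
  \<comment> \<open>\<open>app_iso\<close> takes the image of the arc set, so equality is needed;
    surjectivity of \<open>f\<close> supplies the preimages.\<close>
  moreover have "map_prod f f ` parcs (rotational_digraph n S) = parcs (rotational_digraph n R)"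
  proof (intro equalityI subsetI)
    fix a assume "a \<in> map_prod f f ` parcs (rotational_digraph n S)"
    then show "a \<in> parcs (rotational_digraph n R)"
      using f_range arc by (auto simp: rotational_digraph_def simp del: atLeastLessThan_iff)
  next
    fix a assume a: "a \<in> parcs (rotational_digraph n R)"
    then have "fst a \<in> f ` {0..<int n}" "snd a \<in> f ` {0..<int n}"
      unfolding surj by (auto simp: rotational_digraph_def)
    then obtain i j where ij: "i \<in> {0..<int n}" "j \<in> {0..<int n}" "a = (f i, f j)"
      by (metis imageE prod.collapse)
    then have "(i, j) \<in> parcs (rotational_digraph n S)"
      using a arc by (auto simp: rotational_digraph_def)
    then show "a \<in> map_prod f f ` parcs (rotational_digraph n S)"
      using ij(3) by force
  qed
  then have "with_proj (rotational_digraph n R) = app_iso ?hom ?T"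
    using surj by (simp add: app_iso_def with_proj_def rotational_digraph_def)
  ultimately show ?thesis
    unfolding digraph_iso_def by blast
qed

lemma rotational_symbol_mod_neg:
  assumes S: "rotational_symbol k S" and x: "\<not> 2 * int k + 1 dvd x"
  shows "(- x) mod (2 * int k + 1) \<in> S \<longleftrightarrow> x mod (2 * int k + 1) \<notin> S"
proof -
  have "x mod (2 * int k + 1) \<noteq> 0" using x by (simp add: dvd_eq_mod_eq_0)
  moreover have "0 \<le> x mod (2 * int k + 1)" "x mod (2 * int k + 1) < 2 * int k + 1"
    by (simp_all add: pos_mod_bound del: zmod_le_nonneg_dividend zle_add1_eq_le)
  ultimately have "x mod (2 * int k + 1) \<in> {1..2 * int k}"
    unfolding atLeastAtMost_iff by linarith
  from rotational_symbol_neg[OF S this] show ?thesis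
    using \<open>x mod (2 * int k + 1) \<noteq> 0\<close> by (simp add: zmod_zminus1_eq_if)
qed

lemma rotational_symbol_disjoint_translate:
  fixes d :: int
  defines "c \<equiv> - 2 * d"
  assumes S: "rotational_symbol k S"
    and d: "d mod (2 * int k + 1) \<in> S"
    and disj: "\<And>x. x mod (2 * int k + 1) \<in> S \<Longrightarrow> (x - d) mod (2 * int k + 1) \<notin> S"
  shows "S = (\<lambda>j. (c * j) mod (2 * int k + 1)) ` {1..int k}"
proof -
  define n where "n = 2 * int k + 1"
  define P where "P = (\<lambda>x. x mod n \<in> S)"
  have Sn: "S \<subseteq> {1..<n}" and card: "card S = k"
    using S by (auto simp: rotational_symbol_def n_def)
  have cong: "P x \<longleftrightarrow> P y" if "n dvd x - y" for x y
    using that by (simp add: P_def mod_eq_dvd_iff[symmetric])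
  have Pnz: "\<not> n dvd x" if "P x" for x
    using that Sn by (auto simp: P_def dvd_eq_mod_eq_0)
  have neg: "P (- x) \<longleftrightarrow> \<not> P x" if "\<not> n dvd x" for x
    using rotational_symbol_mod_neg[OF S] that by (simp add: P_def n_def)
  have Pd: "P d" and Pdisj: "P x \<Longrightarrow> \<not> P (x - d)" for x
    using d disj by (auto simp: P_def n_def)
  have step1: "P (- x - d)" if "P x" for x
  proof -
    have "\<not> P (x + d)" using Pdisj[of "x + d"] that by auto
    \<comment> \<open>Otherwise \<open>x\<close> would be congruent to \<open>- d\<close>, which is
      outside \<open>S\<close> because \<open>d\<close> is in it.\<close>
    moreover have "\<not> n dvd x + d"
      using neg[OF Pnz[OF Pd]] Pd that cong[of x "- d"] by auto
    ultimately show ?thesis using neg[of "x + d"] by simp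
  qed
  have step2: "P (d - x)" if "P x" "\<not> n dvd x - d" for x
    using neg[OF that(2)] Pdisj[OF that(1)] by simp
  \<comment> \<open>Apply \<open>step1\<close>, then \<open>step2\<close>:
    \<open>d - (- x - d) = x + 2 * d = x - c\<close>. The exception of \<open>step2\<close>,
    \<open>- x - d\<close> congruent to \<open>d\<close>, becomes \<open>x\<close> congruent to
    \<open>c\<close>.\<close>
  have step: "P (x - c)" if "P x" "\<not> n dvd x - c" for x
  proof -
    have "\<not> n dvd (- x - d) - d"
      using that(2) dvd_minus_iff[of n "x - c"] by (simp add: c_def algebra_simps)
    from step2[OF step1[OF that(1)] this] show ?thesis by (simp add: c_def algebra_simps)
  qed
  have sub: "S \<subseteq> (\<lambda>j. (c * j) mod n) ` {1..int k}"
  proof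
    fix x assume x: "x \<in> S"
    then have xmod: "x mod n = x" using Sn by auto
    show "x \<in> (\<lambda>j. (c * j) mod n) ` {1..int k}"
    proof (rule ccontr)
      assume no: "x \<notin> (\<lambda>j. (c * j) mod n) ` {1..int k}"
      \<comment> \<open>The descent could only stop at \<open>x\<close> congruent to
        \<open>c * (j + 1)\<close>, which \<open>no\<close> excludes while
        \<open>j < k\<close>.\<close>
      have "P (x - c * int j)" if "j \<le> k" for j
        using that
      proof (induction j)
        case 0
        then show ?case using x xmod by (simp add: P_def)
      next
        case (Suc j)
        have "int (Suc j) \<in> {1..int k}" using Suc.prems by simp
        then have "x mod n \<noteq> (c * int (Suc j)) mod n" using no xmod by (metis imageI)
        then have "\<not> n dvd (x - c * int j) - c"
          by (simp add: mod_eq_dvd_iff algebra_simps)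
        from step[OF _ this] show ?case using Suc by (simp add: algebra_simps)
      qed
      then have "P (x - c * int k)" by simp
      moreover have "(x - c * int k) - (x - d) = n * d"
        by (simp add: c_def n_def algebra_simps)
      ultimately have "P (x - d)" using cong by (metis dvd_triv_left)
      then show False using Pdisj[of x] x xmod by (simp add: P_def)
    qed
  qed
  have "card ((\<lambda>j. (c * j) mod n) ` {1..int k}) \<le> card S"
    using card_image_le[of "{1..int k}" "\<lambda>j. (c * j) mod n"] card by simp
  then show ?thesis
    using card_seteq[OF _ sub] by (simp add: n_def)
qed

lemma rotational_symbol_disjoint_translate_iso:
  fixes d :: int
  assumes S: "rotational_symbol k S"
    and d: "d mod (2 * int k + 1) \<in> S"
    and disj: "\<And>x. x mod (2 * int k + 1) \<in> S \<Longrightarrow> (x - d) mod (2 * int k + 1) \<notin> S"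
  shows "digraph_iso (with_proj (rotational_digraph (2 * k + 1) S))
    (with_proj (U_tournament (2 * k + 1)))"
proof -
  define n where "n = 2 * int k + 1"
  define c where "c = - 2 * d"
  have int_n: "int (2 * k + 1) = n" by (simp add: n_def)
  have eq: "S = (\<lambda>j. (c * j) mod n) ` {1..int k}"
    using rotational_symbol_disjoint_translate[OF S d disj] by (simp add: c_def n_def)
  \<comment> \<open>This makes \<open>n > 1\<close>, so that 1 is a nonzero residue and 1 or -1 lies
    in \<open>S\<close>.\<close>
  have "k \<noteq> 0" using d eq by auto
  then have "\<not> n dvd 1" by (auto simp: n_def zdvd_not_zless)
  then have "1 mod n \<in> S \<or> (- 1) mod n \<in> S"
    using rotational_symbol_mod_neg[OF S, of 1] by (auto simp: n_def)
  then obtain j where "1 mod n = (c * j) mod n \<or> (- 1) mod n = (c * j) mod n"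
    unfolding eq by blast
  \<comment> \<open>The inverse of \<open>c\<close> is \<open>j\<close> or \<open>- j\<close>,
    according to which of 1 and -1 equals \<open>c * j\<close>.\<close>
  then have "\<exists>e. (e * c) mod n = 1 mod n"
  proof
    assume "1 mod n = (c * j) mod n"
    then show ?thesis by (intro exI[of _ j]) (simp add: mult.commute)
  next
    assume "(- 1) mod n = (c * j) mod n"
    then have "(- (- 1)) mod n = (- (c * j)) mod n" by (rule mod_minus_cong)
    then show ?thesis by (intro exI[of _ "- j"]) (simp add: mult.commute)
  qed
  then obtain e where e: "(e * c) mod n = 1 mod n" by blast
  have R: "x mod n \<in> {1..int k} \<longleftrightarrow> (c * x) mod n \<in> S" for x
  proof
    assume "x mod n \<in> {1..int k}"
    then have "(c * (x mod n)) mod n \<in> S" unfolding eq by blast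
    then show "(c * x) mod n \<in> S" by (simp add: mod_mult_right_eq)
  next
    assume "(c * x) mod n \<in> S"
    then obtain i where i: "i \<in> {1..int k}" "(c * x) mod n = (c * i) mod n"
      unfolding eq by blast
    \<comment> \<open>Multiplying by \<open>e\<close> cancels \<open>c\<close>, and
      \<open>i \<le> k < n\<close> is its own residue.\<close>
    have ec: "(e * (c * y)) mod n = y mod n" for y
      using e by (metis mod_mult_left_eq mult.assoc mult_1)
    have "x mod n = i mod n"
      using i(2) ec by (metis mod_mult_right_eq)
    moreover have "i mod n = i" using i(1) by (simp add: n_def)
    ultimately show "x mod n \<in> {1..int k}" using i(1) by simp
  qed
  have "digraph_iso (with_proj (rotational_digraph (2 * k + 1) S))
      (with_proj (rotational_digraph (2 * k + 1) {1..int k}))"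
    by (rule rotational_digraph_iso_mult[of _ e c]) (unfold int_n, use e R in auto)
  then show ?thesis by (simp add: U_tournament_def)
qed

theorem theorem18:
  fixes k n :: nat and T :: "int pair_pre_digraph"
  assumes "n = 2 * k + 1"
    and "rotational_tournament k T"
  shows "digraph_iso (with_proj T) (with_proj (U_tournament n)) \<or>
    (\<forall>u \<in> verts (with_proj T). \<forall>v \<in> verts (with_proj T). u \<noteq> v \<longrightarrow>
       out_set (with_proj T) u \<inter> out_set (with_proj T) v \<noteq> {})"
proof (rule disjCI)
  assume "\<not> (\<forall>u \<in> verts (with_proj T). \<forall>v \<in> verts (with_proj T). u \<noteq> v \<longrightarrow>
       out_set (with_proj T) u \<inter> out_set (with_proj T) v \<noteq> {})"
  then obtain u v where uv: "u \<in> verts (with_proj T)" "v \<in> verts (with_proj T)" "u \<noteq> v"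
    and empty: "out_set (with_proj T) u \<inter> out_set (with_proj T) v = {}"
    by blast
  obtain S where S: "rotational_symbol k S" and T: "T = rotational_digraph (2 * k + 1) S"
    using assms(2) by (auto simp: rotational_tournament_def)
  define m where "m = 2 * int k + 1"
  have int_m: "int (2 * k + 1) = m" by (simp add: m_def)
  have mpos: "m > 0" by (simp add: m_def)
  have arc: "(x \<rightarrow>\<^bsub>with_proj T\<^esub> y) \<longleftrightarrow> (y - x) mod m \<in> S" if "x \<in> {0..<m}" "y \<in> {0..<m}" for x y
    using that unfolding T rotational_digraph_def int_m by simp
  have verts: "verts (with_proj T) = {0..<m}"
    unfolding T rotational_digraph_def int_m by simp
  have iso: "digraph_iso (with_proj T) (with_proj (U_tournament n))"
    if ab: "a \<in> {0..<m}" "b \<in> {0..<m}" and beats: "a \<rightarrow>\<^bsub>with_proj T\<^esub> b"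
      and disj: "out_set (with_proj T) a \<inter> out_set (with_proj T) b = {}" for a b
    unfolding T assms(1)
  proof (rule rotational_symbol_disjoint_translate_iso[OF S, of "b - a"])
    show "(b - a) mod (2 * int k + 1) \<in> S"
      using beats arc[OF ab] by (simp add: m_def)
    fix x assume "x mod (2 * int k + 1) \<in> S"
    then have x: "x mod m \<in> S" by (simp add: m_def)
    \<comment> \<open>The vertex at offset \<open>x\<close> from \<open>a\<close>: it is beaten by
      \<open>a\<close>, hence not by \<open>b\<close>.\<close>
    define w where "w = (x + a) mod m"
    have w: "w \<in> {0..<m}" using mpos by (simp add: w_def)
    have "(w - a) mod m = x mod m" "(w - b) mod m = (x - (b - a)) mod m"
      by (simp_all add: w_def mod_diff_left_eq algebra_simps)
    then have "(x - (b - a)) mod m \<notin> S"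
      using disj x w arc[OF ab(1) w] arc[OF ab(2) w] unfolding out_set_def verts by auto
    then show "(x - (b - a)) mod (2 * int k + 1) \<notin> S" by (simp add: m_def)
  qed
  have "(u \<rightarrow>\<^bsub>with_proj T\<^esub> v) \<or> (v \<rightarrow>\<^bsub>with_proj T\<^esub> u)"
    using rotational_tournament_arcs[OF assms(2) uv(1,2)] uv(3) by blast
  then show "digraph_iso (with_proj T) (with_proj (U_tournament n))"
    using iso[of u v] iso[of v u] uv(1,2) empty unfolding verts by blast
qed

end
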